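(* Let $(R,B,L)$ be a Hadamard system in $\mathbb{R}^d$. Then both of the orthogonal systems $\Gamma(B)$ (orthogonal in $L^2(\mu_L)$) and $\Gamma(L)$ (orthogonal in $L^2(\mu_B)$) are infinite.
   Context: Hadamard system $(R,B,L)$ in $\mathbb{R}^d$: $R$ is a $d\times d$ matrix with integer entries which is expansive (all eigenvalues $\lambda$ satisfy $|\lambda|>1$); $B,L\subset\mathbb{R}^d$ are finite sets with $0\in B$, $0\in L$, $\#B=\#L=N$; $R^k b\cdot l\in\mathbb{Z}$ for all $b\in B$, $l\in L$ and all integers $k\ge 0$; and the $N\times N$ matrix $\frac{1}{\sqrt N}\left(e^{2\pi i R^{-1}b\cdot l}\right)_{b\in B,\,l\in L}$ is unitary. Measures: $\mu_B$ is the unique Borel probability measure on $\mathbb{R}^d$ with $\mu_B=\frac1N\sum_{b\in B}\mu_B\circ\tau_b^{-1}$, where $\tau_b(x)=R^{-1}(x+b)$; $\mu_L$ is the unique Borel probability measure on $\mathbb{R}^d$ with $\mu_L=\frac1N\sum_{l\in L}\mu_L\circ\sigma_l^{-1}$, where $\sigma_l(x)=(R^T)^{-1}(x+l)$. Discrete sets: $\Gamma(B)=\{\sum_{k=0}^n R^k b_k : b_k\in B,\ n\in\mathbb{Z}_+\}$ and $\Gamma(L)=\{\sum_{k=0}^n (R^T)^k l_k : l_k\in L,\ n\in\mathbb{Z}_+\}$. A set $\Gamma\subset\mathbb{R}^d$ is called orthogonal in $L^2(\mu)$ if the exponentials $e_\gamma(x)=e^{2\pi i\gamma\cdot x}$,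 $\gamma\in\Gamma$, are mutually orthogonal in $L^2(\mu)$; it is known that for a Hadamard system $\Gamma(B)$ is orthogonal in $L^2(\mu_L)$ and $\Gamma(L)$ is orthogonal in $L^2(\mu_B)$.
   Formalization: The formal statement assumes N = #B ≥ 2; for N = 1 one has B = L = {0}, which meets every condition of a Hadamard system, yet Γ(B) = Γ(L) = {0} is finite. *)

theory Defs
  imports "HOL-Probability.Probability"
begin

text \<open>Eigenvalues of a real matrix are taken over the complex numbers.\<close>

definition complex_eigenvalue :: "real^'n^'n \<Rightarrow> complex \<Rightarrow> bool" where
  "complex_eigenvalue R z \<longleftrightarrow>
     (\<exists>v::complex^'n. v \<noteq> 0 \<and> map_matrix complex_of_real R *v v = z *s v)"

definition expansive :: "real^'n^'n \<Rightarrow> bool" where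
  "expansive R \<longleftrightarrow> (\<forall>z. complex_eigenvalue R z \<longrightarrow> cmod z > 1)"

text \<open>
  \<open>U\<close> is read as a matrix with rows indexed by \<open>I\<close> and columns by \<open>J\<close>. The two conjuncts are
  the equations \<open>U U* = 1\<close> and \<open>U* U = 1\<close>.
\<close>

definition unitary_on :: "'a set \<Rightarrow> 'b set \<Rightarrow> ('a \<Rightarrow> 'b \<Rightarrow> complex) \<Rightarrow> bool" where
  "unitary_on I J U \<longleftrightarrow>
     (\<forall>i\<in>I. \<forall>i'\<in>I. (\<Sum>j\<in>J. U i j * cnj (U i' j)) = (if i = i' then 1 else 0)) \<and>
     (\<forall>j\<in>J. \<forall>j'\<in>J. (\<Sum>i\<in>I. cnj (U i j) * U i j') = (if j = j' then 1 else 0))"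

text \<open>
  The type class power on \<^typ>\<open>real^'n^'n\<close> is taken entrywise, so powers of a matrix are written as
  iterates of the linear map \<open>(*v) R\<close>.
\<close>

definition hadamard_system :: "real^'n^'n \<Rightarrow> (real^'n) set \<Rightarrow> (real^'n) set \<Rightarrow> bool" where
  "hadamard_system R B L \<longleftrightarrow>
     (\<forall>i j. R $ i $ j \<in> \<int>) \<and> expansive R \<and>
     finite B \<and> finite L \<and> 0 \<in> B \<and> 0 \<in> L \<and> card B = card L \<and>
     (\<forall>b\<in>B. \<forall>l\<in>L. \<forall>k. (((*v) R ^^ k) b) \<bullet> l \<in> \<int>) \<and>
     unitary_on B L (\<lambda>b l. complex_of_real (1 / sqrt (real (card B))) *
        exp (2 * of_real pi * \<i> * of_real ((matrix_inv R *v b) \<bullet> l)))"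

text \<open>
  The measure \<open>\<mu>\<^sub>B\<close> is characterised by \<open>invariant_measure R B\<close>, and \<open>\<mu>\<^sub>L\<close> by
  \<open>invariant_measure (transpose R) L\<close>.
\<close>

definition invariant_measure :: "real^'n^'n \<Rightarrow> (real^'n) set \<Rightarrow> (real^'n) measure \<Rightarrow> bool" where
  "invariant_measure R B \<mu> \<longleftrightarrow>
     prob_space \<mu> \<and> sets \<mu> = sets borel \<and>
     (\<forall>A\<in>sets borel. measure \<mu> A =
        1 / real (card B) * (\<Sum>b\<in>B. measure \<mu> ((\<lambda>x. matrix_inv R *v (x + b)) -` A)))"

definition Gamma_set :: "real^'n^'n \<Rightarrow> (real^'n) set \<Rightarrow> (real^'n) set" where
  "Gamma_set R B = {(\<Sum>k\<le>n. ((*v) R ^^ k) (c k)) | n c. \<forall>k\<le>n. c k \<in> B}"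

definition expo :: "real^'n \<Rightarrow> real^'n \<Rightarrow> complex" where
  "expo g x = exp (2 * of_real pi * \<i> * of_real (g \<bullet> x))"

definition orthogonal_exponentials :: "(real^'n) measure \<Rightarrow> (real^'n) set \<Rightarrow> bool" where
  "orthogonal_exponentials \<mu> \<Gamma> \<longleftrightarrow>
     (\<forall>g\<in>\<Gamma>. \<forall>h\<in>\<Gamma>. g \<noteq> h \<longrightarrow> (\<integral>x. expo g x * cnj (expo h x) \<partial>\<mu>) = 0)"

end

theory Submission
  imports Defs
begin

text \<open>
  Orthogonality. Write \<open>\<phi>(t) = \<integral> e\<^sub>t d\<mu>\<close> for the Fourier transform of an invariant measure \<open>\<mu>\<close> of
  \<open>(R, B)\<close>, and \<open>S\<close> for the transpose of \<open>R\<close>. Invariance gives the refinement equation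
  \<open>\<phi>(S s) = m(s) \<phi>(s)\<close> with the mask \<open>m(s) = (1/N) \<Sum>\<^sub>b e\<^sub>s(b)\<close>
  (\<open>integral_expo_transpose_mult\<close>). Unitarity of the Hadamard matrix says that \<open>m\<close> vanishes at
  \<open>S\<^sup>-\<^sup>1(l - l')\<close> for distinct \<open>l, l'\<close> in \<open>L\<close>, and \<open>m\<close> is unchanged when its argument is shifted by a
  vector whose inner products with \<open>B\<close> are integers (\<open>hadamard_mask_eq_0\<close>). For two digit
  expansions in \<open>\<Gamma>(L)\<close>, the refinement equation strips the common low digits one at a time; at the
  first digit where they differ the mask factor is zero, since the higher digits only contribute
  a shift of the kind just described (\<open>integral_expo_digit_sum_diff_eq_0\<close>).

  Infinitude. If \<open>b\<close> is a nonzero element of \<open>B\<close>, all iterates \<open>R\<^sup>k b\<close> lie in \<open>\<Gamma>(B)\<close>. Were \<open>\<Gamma>(B)\<close>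
  finite, two of them would coincide and, \<open>R\<close> being injective, \<open>R\<^sup>m b = b\<close> for some \<open>m > 0\<close>. Then some
  root of unity is an eigenvalue of \<open>R\<close> (\<open>periodic_vector_imp_eigenvalue_norm_1\<close>), which contradicts
  expansiveness.

  Both arguments are needed for \<open>(R, B, L)\<close> and for the dual triple \<open>(S, L, B)\<close>, which is again a
  Hadamard system (\<open>hadamard_system_transpose\<close>).
\<close>

section \<open>Eigenvalues\<close>

text \<open>A real vector regarded as a complex one.\<close>

definition complexify :: "real^'n \<Rightarrow> complex^'n" where
  "complexify x = (\<chi> i. complex_of_real (x $ i))"

lemma complexify_eq_0_iff [simp]: "complexify x = 0 \<longleftrightarrow> x = 0"
  by (simp add: complexify_def vec_eq_iff)

lemma map_matrix_mult_complexify: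
  "map_matrix complex_of_real R *v complexify x = complexify (R *v x)"
  by (simp add: complexify_def vec_eq_iff matrix_vector_mult_def)

lemma complex_eigenvalue_iff_not_invertible:
  "complex_eigenvalue R z \<longleftrightarrow> \<not> invertible (map_matrix complex_of_real R - mat z)"
proof -
  have mat: "mat z *v v = z *s v" for v :: "complex^'n"
    by (simp add: vec_eq_iff matrix_vector_mult_def mat_def if_distrib [where f = "\<lambda>x. x * _"]
        sum.delta cong: if_cong)
  show ?thesis
    unfolding complex_eigenvalue_def invertible_left_inverse matrix_left_invertible_ker
    by (auto simp: matrix_vector_mult_diff_rdistrib mat)
qed

lemma invertible_transpose_iff: "invertible (transpose A) \<longleftrightarrow> invertible A"
  for A :: "'a::field^'n^'n"
  unfolding invertible_left_inverse left_invertible_transpose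
  using matrix_left_right_inverse by blast

lemma complex_eigenvalue_transpose:
  "complex_eigenvalue (transpose R) z \<longleftrightarrow> complex_eigenvalue R z"
proof -
  have eq: "map_matrix complex_of_real (transpose R) - mat z
      = transpose (map_matrix complex_of_real R - mat z)"
    by (auto simp: vec_eq_iff transpose_def mat_def)
  show ?thesis
    by (simp add: complex_eigenvalue_iff_not_invertible eq invertible_transpose_iff)
qed

lemma expansive_transpose: "expansive (transpose R) \<longleftrightarrow> expansive R"
  by (simp add: expansive_def complex_eigenvalue_transpose)

lemma expansive_imp_invertible:
  assumes "expansive R"
  shows "invertible R"
proof -
  have "x = 0" if "R *v x = 0" for x
  proof (rule ccontr)
    assume "x \<noteq> 0"
    moreover have "map_matrix complex_of_real R *v complexify x = 0 *s complexify x"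
      by (simp add: map_matrix_mult_complexify that)
    ultimately have "complex_eigenvalue R 0"
      unfolding complex_eigenvalue_def using complexify_eq_0_iff by blast
    with assms show False
      by (auto simp: expansive_def)
  qed
  then show ?thesis
    by (simp add: invertible_left_inverse matrix_left_invertible_ker)
qed

text \<open>The \<open>j\<close>-th power of the \<open>k\<close>-th root is the \<open>k\<close>-th power of the \<open>j\<close>-th root: a geometric series.\<close>

lemma sum_powers_of_roots_of_unity:
  assumes "0 < j" "j < m"
  shows "(\<Sum>k<m. (exp (2 * of_real pi * \<i> * of_nat k / of_nat m) :: complex) ^ j) = 0"
proof -
  define q :: complex where "q = exp (2 * of_real pi * \<i> * of_nat j / of_nat m)"
  have "q ^ m = 1"
    using assms by (simp add: q_def complex_root_unity)
  have "q \<noteq> 1"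
    using assms complex_root_unity_eq_1 [of m j] by (auto simp: q_def dest: nat_dvd_not_less)
  have "(\<Sum>k<m. (exp (2 * of_real pi * \<i> * of_nat k / of_nat m) :: complex) ^ j) = (\<Sum>k<m. q ^ k)"
    by (simp add: q_def flip: exp_of_nat_mult) (simp add: mult_ac)
  also have "\<dots> = 0"
    using \<open>q ^ m = 1\<close> \<open>q \<noteq> 1\<close> by (simp add: geometric_sum)
  finally show ?thesis .
qed

text \<open>
  Discrete Fourier analysis along the orbit: for each \<open>m\<close>-th root of unity \<open>w\<close>, the component
  \<open>\<Sum>\<^sub>j w\<^sup>j R\<^sup>j x\<close> is either zero or an eigenvector with eigenvalue \<open>1/w\<close>. The components sum to
  \<open>m x\<close>, so one of them is nonzero.
\<close>

lemma periodic_vector_imp_eigenvalue_norm_1: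
  fixes R :: "real^'n^'n"
  assumes "0 < m" and period: "((*v) R ^^ m) x = x" and "x \<noteq> 0"
  shows "\<exists>z. complex_eigenvalue R z \<and> cmod z = 1"
proof -
  define A where "A = map_matrix complex_of_real R"
  define u where "u j = complexify (((*v) R ^^ j) x)" for j
  define v where "v w = (\<Sum>j<m. w ^ j *s u j)" for w
  define w where "w k = (exp (2 * of_real pi * \<i> * of_nat k / of_nat m) :: complex)" for k
  have A_u: "A *v u j = u (Suc j)" for j
    by (simp add: A_def u_def map_matrix_mult_complexify)
  have root: "w k ^ m = 1" for k
    using \<open>0 < m\<close> by (simp add: w_def complex_root_unity)
  have norm: "cmod (w k) = 1" for k
    by (simp add: w_def norm_exp_eq_Re)
  have A_v: "w k *s (A *v v (w k)) = v (w k)" for k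
  proof -
    have "w k *s (A *v v (w k)) = (\<Sum>j<m. w k ^ Suc j *s u (Suc j))"
      by (simp add: v_def vec.linear_sum [OF matrix_vector_mul_linear_gen] vec.scale_sum_right
          vector_scalar_commute A_u)
    also have "\<dots> = (\<Sum>j<m. w k ^ j *s u j)"
      using sum.lessThan_Suc_shift [of "\<lambda>j. w k ^ j *s u j" m] \<open>0 < m\<close>
      by (simp add: root u_def period)
    finally show ?thesis by (simp add: v_def)
  qed
  have "(\<Sum>k<m. v (w k)) = (\<Sum>j<m. (\<Sum>k<m. w k ^ j) *s u j)"
    unfolding v_def by (subst sum.swap) (simp add: vec.scale_sum_left)
  also have "\<dots> = (\<Sum>j<m. if j = 0 then of_nat m *s u 0 else 0)"
    by (rule sum.cong) (auto simp: w_def sum_powers_of_roots_of_unity)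
  also have "\<dots> = of_nat m *s u 0"
    using \<open>0 < m\<close> by simp
  also have "\<dots> \<noteq> 0"
    using \<open>0 < m\<close> \<open>x \<noteq> 0\<close> by (simp add: u_def)
  finally obtain k where "v (w k) \<noteq> 0"
    by (metis (no_types, lifting) sum.neutral)
  moreover have "A *v v (w k) = inverse (w k) *s v (w k)"
  proof -
    have "inverse (w k) *s (w k *s (A *v v (w k))) = A *v v (w k)"
      using norm [of k] by (cases "w k = 0") auto
    then show ?thesis by (simp only: A_v)
  qed
  ultimately have "complex_eigenvalue R (inverse (w k))"
    unfolding complex_eigenvalue_def A_def by blast
  then show ?thesis
    using norm by (metis inverse_1 norm_inverse)
qed

section \<open>The digit sets are infinite\<close>

lemma Gamma_set_iterate:
  assumes "0 \<in> B" "b \<in> B"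
  shows "((*v) R ^^ k) b \<in> Gamma_set R B"
proof -
  have zero: "((*v) R ^^ i) 0 = 0" for i
    by (induction i) auto
  have "((*v) R ^^ k) b = (\<Sum>i\<le>k. ((*v) R ^^ i) (if i = k then b else 0))"
    by (simp add: zero if_distrib [where f = "(*v) R ^^ _"] cong: if_cong)
  then show ?thesis
    unfolding Gamma_set_def using assms
    by (intro CollectI exI [of _ k] exI [of _ "\<lambda>i. if i = k then b else 0"]) auto
qed

lemma infinite_Gamma_set:
  assumes "expansive R" "0 \<in> B" "b \<in> B" "b \<noteq> 0"
  shows "infinite (Gamma_set R B)"
proof
  assume fin: "finite (Gamma_set R B)"
  have "\<not> inj (\<lambda>k. ((*v) R ^^ k) b)"
  proof
    assume "inj (\<lambda>k. ((*v) R ^^ k) b)"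
    moreover have "range (\<lambda>k. ((*v) R ^^ k) b) \<subseteq> Gamma_set R B"
      using assms Gamma_set_iterate by auto
    ultimately show False
      using fin finite_subset finite_imageD infinite_UNIV_nat by blast
  qed
  then obtain i j where "i < j" and eq: "((*v) R ^^ i) b = ((*v) R ^^ j) b"
    unfolding inj_def by (metis linorder_neqE_nat)
  have inj: "inj ((*v) R ^^ i)"
    using expansive_imp_invertible [OF \<open>expansive R\<close>]
    by (intro inj_fn) (auto simp: invertible_left_inverse matrix_left_invertible_injective)
  have "((*v) R ^^ i) (((*v) R ^^ (j - i)) b) = ((*v) R ^^ i) b"
    using eq \<open>i < j\<close> by (simp flip: funpow_add comp_apply [of "(*v) R ^^ i"])
  then have "((*v) R ^^ (j - i)) b = b"
    using inj by (simp add: inj_eq)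
  then obtain z where "complex_eigenvalue R z" "cmod z = 1"
    using periodic_vector_imp_eigenvalue_norm_1 [of "j - i" R b] \<open>i < j\<close> \<open>b \<noteq> 0\<close> by auto
  then show False
    using \<open>expansive R\<close> by (auto simp: expansive_def)
qed

section \<open>Duality of Hadamard systems\<close>

lemma matrix_inv_mult_left:
  fixes R :: "'a::field^'n^'n"
  assumes "invertible R"
  shows "matrix_inv R ** R = mat 1"
  using assms unfolding invertible_def matrix_inv_def by (metis (mono_tags, lifting) someI_ex)

lemma matrix_inv_mult_right:
  fixes R :: "'a::field^'n^'n"
  assumes "invertible R"
  shows "R ** matrix_inv R = mat 1"
  using matrix_inv_mult_left [OF assms] matrix_left_right_inverse by blast

lemma matrix_inv_transpose:
  fixes R :: "'a::field^'n^'n"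
  assumes "invertible R"
  shows "matrix_inv (transpose R) = transpose (matrix_inv R)"
proof -
  have "transpose R ** transpose (matrix_inv R) = mat 1"
    by (metis assms matrix_inv_mult_left matrix_transpose_mul transpose_mat)
  moreover have "matrix_inv (transpose R) ** transpose R = mat 1"
    by (simp add: assms matrix_inv_mult_left invertible_transpose_iff)
  ultimately show ?thesis
    by (metis matrix_mul_assoc matrix_mul_lid matrix_mul_rid)
qed

lemma inner_transpose_mult: "(transpose R *v x) \<bullet> y = x \<bullet> (R *v y)"
  for R :: "real^'n^'m"
  by (simp add: dot_lmul_matrix)

lemma inner_transpose_iterate:
  "((*v) (transpose R) ^^ k) x \<bullet> y = x \<bullet> ((*v) R ^^ k) y" for R :: "real^'n^'n"
proof (induction k arbitrary: y)
  case (Suc k)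
  then show ?case
    by (simp only: funpow.simps comp_apply inner_transpose_mult, simp only: funpow_swap1)
qed simp

lemma hadamard_system_transpose:
  assumes "hadamard_system R B L"
  shows "hadamard_system (transpose R) L B"
proof -
  have inv: "invertible R"
    using assms by (auto simp: hadamard_system_def intro: expansive_imp_invertible)
  define U where "U b l = complex_of_real (1 / sqrt (real (card B))) *
      exp (2 * of_real pi * \<i> * of_real ((matrix_inv R *v b) \<bullet> l))" for b l
  have U: "unitary_on B L U" and card: "card B = card L"
    using assms by (auto simp: hadamard_system_def U_def [abs_def])
  have U': "complex_of_real (1 / sqrt (real (card L))) *
      exp (2 * of_real pi * \<i> * of_real ((matrix_inv (transpose R) *v l) \<bullet> b)) = U b l" for b l
    by (simp only: U_def card matrix_inv_transpose [OF inv] inner_transpose_mult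
        inner_commute [of "matrix_inv R *v b"])
  have "unitary_on L B (\<lambda>l b. U b l)"
    unfolding unitary_on_def
  proof (intro conjI ballI)
    fix l l' assume "l \<in> L" "l' \<in> L"
    then have "(\<Sum>b\<in>B. cnj (U b l') * U b l) = (if l' = l then 1 else 0)"
      using U by (simp add: unitary_on_def)
    then show "(\<Sum>b\<in>B. U b l * cnj (U b l')) = (if l = l' then 1 else 0)"
      by (cases "l = l'") (simp_all add: mult.commute)
  next
    fix b b' assume "b \<in> B" "b' \<in> B"
    then have "(\<Sum>l\<in>L. U b' l * cnj (U b l)) = (if b' = b then 1 else 0)"
      using U by (simp add: unitary_on_def)
    then show "(\<Sum>l\<in>L. cnj (U b l) * U b' l) = (if b = b' then 1 else 0)"
      by (cases "b = b'") (simp_all add: mult.commute)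
  qed
  then show ?thesis
    using assms unfolding hadamard_system_def U' expansive_transpose inner_transpose_iterate
    by (auto simp: inner_commute transpose_def)
qed

section \<open>The refinement equation\<close>

lemma expo_mult_cnj: "expo g x * cnj (expo h x) = expo (g - h) x"
  by (simp add: expo_def exp_cnj inner_diff_left algebra_simps flip: exp_add)

lemma expo_add_right: "expo t (x + y) = expo t x * expo t y"
  by (simp add: expo_def inner_add_right algebra_simps flip: exp_add)

lemma borel_measurable_expo [measurable]: "expo t \<in> borel_measurable borel"
  unfolding expo_def [abs_def] by measurable

lemma norm_expo [simp]: "norm (expo t x) = 1"
  by (simp add: expo_def norm_exp_eq_Re)

lemma expo_inner_Ints: "t \<bullet> x \<in> \<int> \<Longrightarrow> expo t x = 1"
  unfolding expo_def by (auto elim!: Ints_cases simp: exp_eq_1) 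

lemma borel_measurable_affine [measurable]:
  "(\<lambda>x. A *v (x + b)) \<in> borel_measurable borel" for A :: "real^'n^'m"
  by (intro borel_measurable_continuous_onI continuous_intros
      continuous_on_compose2 [OF matrix_vector_mult_linear_continuous_on]) auto

text \<open>
  The invariance identity for sets says that \<open>\<mu>\<close> is the law of \<open>R\<^sup>-\<^sup>1 (x + b)\<close> when \<open>b\<close> is first drawn
  uniformly from \<open>B\<close> and \<open>x\<close> then from \<open>\<mu>\<close>; integration against this mixture gives the identity for
  bounded functions.
\<close>

lemma integral_invariant_measure:
  fixes f :: "real^'n \<Rightarrow> real"
  assumes inv: "invariant_measure R B \<mu>" and B: "finite B" "B \<noteq> {}"
    and [measurable]: "f \<in> borel_measurable borel" and bound: "\<And>x. \<bar>f x\<bar> \<le> C"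
  shows "(\<integral>x. f x \<partial>\<mu>) = (\<Sum>b\<in>B. \<integral>x. f (matrix_inv R *v (x + b)) \<partial>\<mu>) / real (card B)"
proof -
  interpret prob_space \<mu>
    using inv by (simp add: invariant_measure_def)
  have [measurable_cong]: "sets \<mu> = sets borel"
    using inv by (simp add: invariant_measure_def)
  then have [simp]: "space \<mu> = UNIV"
    using sets_eq_imp_space_eq by fastforce
  define K where "K b = distr \<mu> borel (\<lambda>x. matrix_inv R *v (x + b))" for b
  have K_prob: "prob_space (K b)" for b
    unfolding K_def by (rule prob_space_distr) measurable
  have K_sets: "sets (K b) = sets borel" for b
    by (simp add: K_def)
  have K: "K \<in> measurable (measure_pmf (pmf_of_set B)) (subprob_algebra borel)"
    using K_prob K_sets by (simp add: space_subprob_algebra prob_space_imp_subprob_space)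
  interpret bind: prob_space "measure_pmf (pmf_of_set B) \<bind> K"
    by (rule prob_space.prob_space_bind [OF _ _ K]) (auto simp: K_prob measure_pmf.prob_space_axioms)
  have sets_bind: "sets (measure_pmf (pmf_of_set B) \<bind> K) = sets borel"
    by (rule sets_bind) (auto simp: K_sets)
  have "\<mu> = measure_pmf (pmf_of_set B) \<bind> K"
  proof (rule measure_eqI)
    fix A assume "A \<in> sets \<mu>"
    then have [measurable]: "A \<in> sets borel" by (simp add: \<open>sets \<mu> = sets borel\<close>)
    have "measure (measure_pmf (pmf_of_set B) \<bind> K) A = (\<integral>b. measure (K b) A \<partial>measure_pmf (pmf_of_set B))"
      by (rule measure_pmf.measure_bind [OF K]) simp
    also have "\<dots> = (\<Sum>b\<in>B. measure \<mu> ((\<lambda>x. matrix_inv R *v (x + b)) -` A)) / real (card B)"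
      using B by (simp add: integral_pmf_of_set K_def measure_distr)
    also have "\<dots> = measure \<mu> A"
      using inv by (simp add: invariant_measure_def)
    finally show "emeasure \<mu> A = emeasure (measure_pmf (pmf_of_set B) \<bind> K) A"
      by (simp add: emeasure_eq_measure bind.emeasure_eq_measure)
  qed (simp add: sets_bind \<open>sets \<mu> = sets borel\<close>)
  then have "(\<integral>x. f x \<partial>\<mu>) = (\<integral>x. f x \<partial>(measure_pmf (pmf_of_set B) \<bind> K))"
    by simp
  also have "\<dots> = (\<integral>b. (\<integral>x. f x \<partial>K b) \<partial>measure_pmf (pmf_of_set B))"
    by (rule integral_bind [OF _ _ K, where B = C and B' = 1])
      (auto simp: bound measure_pmf.finite_measure_axioms prob_space.emeasure_space_1 [OF K_prob])
  also have "\<dots> = (\<Sum>b\<in>B. \<integral>x. f x \<partial>K b) / real (card B)"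
    using B by (simp add: integral_pmf_of_set)
  also have "\<dots> = (\<Sum>b\<in>B. \<integral>x. f (matrix_inv R *v (x + b)) \<partial>\<mu>) / real (card B)"
    by (simp add: K_def integral_distr)
  finally show ?thesis .
qed

lemma integral_expo_invariant_measure:
  assumes inv: "invariant_measure R B \<mu>" and B: "finite B" "B \<noteq> {}"
  shows "(\<integral>x. expo t x \<partial>\<mu>)
    = (\<Sum>b\<in>B. \<integral>x. expo t (matrix_inv R *v (x + b)) \<partial>\<mu>) / of_nat (card B)"
proof -
  interpret prob_space \<mu>
    using inv by (simp add: invariant_measure_def)
  have [measurable_cong]: "sets \<mu> = sets borel"
    using inv by (simp add: invariant_measure_def)
  have int: "integrable \<mu> (\<lambda>x. expo t (g x))" if [measurable]: "g \<in> borel_measurable borel" for g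
    by (rule integrable_const_bound [where B = 1]) auto
  have int_affine: "integrable \<mu> (\<lambda>x. expo t (matrix_inv R *v (x + b)))" for b
    by (rule int) measurable
  have int_id: "integrable \<mu> (\<lambda>x. expo t x)"
    by (rule int) measurable
  have div: "z / of_nat n = z /\<^sub>R real n" for z :: complex and n
    by (simp add: scaleR_conv_of_real divide_inverse_commute)
  have "\<bar>Re (expo t x)\<bar> \<le> 1" "\<bar>Im (expo t x)\<bar> \<le> 1" for x
    using abs_Re_le_cmod [of "expo t x"] abs_Im_le_cmod [of "expo t x"] by simp_all
  then have "(\<integral>x. Re (expo t x) \<partial>\<mu>)
        = (\<Sum>b\<in>B. \<integral>x. Re (expo t (matrix_inv R *v (x + b))) \<partial>\<mu>) / real (card B)"
      "(\<integral>x. Im (expo t x) \<partial>\<mu>)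
        = (\<Sum>b\<in>B. \<integral>x. Im (expo t (matrix_inv R *v (x + b))) \<partial>\<mu>) / real (card B)"
    by (auto intro!: integral_invariant_measure [OF inv B, where C = 1])
  then show ?thesis
    unfolding div by (intro complex_eqI) (simp_all add: int_id int_affine divide_inverse_commute)
qed

text \<open>
  The transposed matrix absorbs the contraction: \<open>(S s) \<bullet> (R\<^sup>-\<^sup>1 y) = s \<bullet> y\<close> for the transpose \<open>S\<close> of \<open>R\<close>.
\<close>

lemma integral_expo_transpose_mult:
  assumes "invariant_measure R B \<mu>" "finite B" "B \<noteq> {}" "invertible R"
  shows "(\<integral>x. expo (transpose R *v s) x \<partial>\<mu>)
    = (\<Sum>b\<in>B. expo s b) / of_nat (card B) * (\<integral>x. expo s x \<partial>\<mu>)"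
proof -
  have "expo (transpose R *v s) (matrix_inv R *v y) = expo s y" for y
    unfolding expo_def inner_transpose_mult
    by (simp add: matrix_vector_mul_assoc matrix_inv_mult_right [OF \<open>invertible R\<close>])
  then have "(\<integral>x. expo (transpose R *v s) x \<partial>\<mu>)
      = (\<Sum>b\<in>B. \<integral>x. expo s (x + b) \<partial>\<mu>) / of_nat (card B)"
    by (subst integral_expo_invariant_measure [OF assms(1-3)]) simp
  also have "(\<Sum>b\<in>B. \<integral>x. expo s (x + b) \<partial>\<mu>) = (\<Sum>b\<in>B. expo s b * (\<integral>x. expo s x \<partial>\<mu>))"
    by (simp add: expo_add_right mult.commute)
  finally show ?thesis
    by (simp del: transpose_matrix_vector flip: sum_distrib_right)
qed

section \<open>Orthogonality\<close>

text \<open>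
  A zero of the mask is produced by two distinct digits of \<open>L\<close>; it persists under a shift \<open>w\<close> because
  \<open>e\<^sub>w(b) = 1\<close> for all \<open>b\<close> in \<open>B\<close>.
\<close>

lemma hadamard_mask_eq_0:
  assumes H: "hadamard_system R B L" and l: "l \<in> L" "l' \<in> L" "l \<noteq> l'"
    and w: "\<And>b. b \<in> B \<Longrightarrow> w \<bullet> b \<in> \<int>"
  shows "(\<Sum>b\<in>B. expo (transpose (matrix_inv R) *v (l - l') + w) b) = 0"
proof -
  define a where "a = complex_of_real (1 / sqrt (real (card B)))"
  have "card B \<noteq> 0"
    using H by (auto simp: hadamard_system_def)
  then have "a \<noteq> 0" by (simp add: a_def)
  have summand: "expo (transpose (matrix_inv R) *v (l - l') + w) b
      = expo l (matrix_inv R *v b) * cnj (expo l' (matrix_inv R *v b))" if "b \<in> B" for b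
  proof -
    have "expo (u + w) b = expo u b" for u
      using expo_inner_Ints [OF w [OF that]]
      by (simp add: expo_def inner_add_left algebra_simps exp_add)
    moreover have "expo (transpose (matrix_inv R) *v v) b = expo v (matrix_inv R *v b)" for v
      by (simp only: expo_def inner_transpose_mult)
    ultimately show ?thesis
      by (simp only: expo_mult_cnj)
  qed
  have "(\<Sum>b\<in>B. cnj (a * expo l' (matrix_inv R *v b)) * (a * expo l (matrix_inv R *v b))) = 0"
    using H l unfolding hadamard_system_def unitary_on_def a_def expo_def
    by (auto simp: inner_commute)
  then have "cnj a * a * (\<Sum>b\<in>B. expo l (matrix_inv R *v b) * cnj (expo l' (matrix_inv R *v b))) = 0"
    by (simp add: sum_distrib_left mult_ac)
  with \<open>a \<noteq> 0\<close> show ?thesis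
    by (simp add: summand del: transpose_matrix_vector)
qed

text \<open>
  Induction on the number of digits: a difference of expansions has the form
  \<open>(c\<^sub>0 - d\<^sub>0) + S w\<close>, where \<open>w\<close> is a difference of expansions with one digit fewer.
\<close>

lemma integral_expo_digit_sum_diff_eq_0:
  fixes R :: "real^'n^'n"
  defines "S \<equiv> transpose R"
  assumes H: "hadamard_system R B L" and inv: "invariant_measure R B \<mu>"
    and "\<And>k. c k \<in> L" "\<And>k. d k \<in> L"
    and "(\<Sum>k<m. ((*v) S ^^ k) (c k)) \<noteq> (\<Sum>k<m. ((*v) S ^^ k) (d k))"
  shows "(\<integral>x. expo ((\<Sum>k<m. ((*v) S ^^ k) (c k)) - (\<Sum>k<m. ((*v) S ^^ k) (d k))) x \<partial>\<mu>) = 0"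
  using assms(4-)
proof (induction m arbitrary: c d)
  case (Suc m)
  have B: "finite B" "B \<noteq> {}" and R: "invertible R"
    using H by (auto simp: hadamard_system_def intro: expansive_imp_invertible)
  define sum' where "sum' c = (\<Sum>k<m. ((*v) S ^^ k) (c (Suc k)))" for c
  define w where "w = sum' c - sum' d"
  have step: "(\<Sum>k<Suc m. ((*v) S ^^ k) (c k)) = c 0 + S *v sum' c" for c
    by (simp add: sum.lessThan_Suc_shift sum'_def vec.linear_sum [OF matrix_vector_mul_linear_gen]
        del: sum.lessThan_Suc)
  have diff: "(\<Sum>k<Suc m. ((*v) S ^^ k) (c k)) - (\<Sum>k<Suc m. ((*v) S ^^ k) (d k))
      = (c 0 - d 0) + S *v w"
    by (simp add: step w_def matrix_vector_mult_diff_distrib del: sum.lessThan_Suc)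
  show ?case
  proof (cases "c 0 = d 0")
    case True
    \<comment> \<open>The difference is \<open>S w\<close>, and the integral of \<open>e\<^sub>w\<close>, a factor of that of \<open>e\<close> at \<open>S w\<close>, vanishes.\<close>
    then have "sum' c \<noteq> sum' d"
      using Suc.prems(3) by (auto simp: step simp del: sum.lessThan_Suc)
    then have "(\<integral>x. expo w x \<partial>\<mu>) = 0"
      unfolding w_def sum'_def using Suc.prems by (intro Suc.IH) auto
    then show ?thesis
      unfolding diff using True integral_expo_transpose_mult [OF inv B R, of w]
      by (simp add: S_def del: transpose_matrix_vector)
  next
    case False
    \<comment> \<open>The difference is \<open>S t\<close>, and the mask vanishes at \<open>t\<close>.\<close>
    define t where "t = transpose (matrix_inv R) *v (c 0 - d 0) + w"
    have "S ** transpose (matrix_inv R) = mat 1"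
      by (simp add: S_def matrix_inv_mult_left [OF R] flip: matrix_transpose_mul)
    then have "(c 0 - d 0) + S *v w = S *v t"
      by (simp add: t_def matrix_vector_right_distrib matrix_vector_mul_assoc
          del: transpose_matrix_vector)
    moreover have "w \<bullet> b \<in> \<int>" if "b \<in> B" for b
    proof -
      have "((*v) S ^^ k) l \<bullet> b \<in> \<int>" if "l \<in> L" for k l
        using H that \<open>b \<in> B\<close> unfolding S_def inner_transpose_iterate
        by (auto simp: hadamard_system_def inner_commute)
      then show ?thesis
        unfolding w_def sum'_def inner_diff_left inner_sum_left
        using Suc.prems by (intro Ints_diff Ints_sum) auto
    qed
    then have "(\<Sum>b\<in>B. expo t b) = 0"
      unfolding t_def using Suc.prems False by (intro hadamard_mask_eq_0 [OF H]) auto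
    ultimately show ?thesis
      unfolding diff using integral_expo_transpose_mult [OF inv B R, of t]
      by (simp add: S_def del: transpose_matrix_vector)
  qed
qed simp

text \<open>
  Since \<open>0\<close> is a digit, an expansion may be padded with zeros, so that any two elements have
  expansions of the same length.
\<close>

lemma Gamma_set_padE:
  assumes "g \<in> Gamma_set R B" "0 \<in> B"
  obtains n c where "\<And>k. c k \<in> B" "\<And>m. n < m \<Longrightarrow> g = (\<Sum>k<m. ((*v) R ^^ k) (c k))"
proof -
  obtain n c where c: "\<forall>k\<le>n. c k \<in> B" and g: "g = (\<Sum>k\<le>n. ((*v) R ^^ k) (c k))"
    using assms by (auto simp: Gamma_set_def)
  define c' where "c' k = (if k \<le> n then c k else 0)" for k
  have zero: "((*v) R ^^ i) 0 = 0" for i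
    by (induction i) auto
  have "g = (\<Sum>k<m. ((*v) R ^^ k) (c' k))" if "n < m" for m
    unfolding g using that by (intro sum.mono_neutral_cong_left) (auto simp: c'_def zero)
  moreover have "c' k \<in> B" for k
    using c \<open>0 \<in> B\<close> by (simp add: c'_def)
  ultimately show ?thesis
    using that by blast
qed

lemma orthogonal_exponentials_Gamma_set:
  assumes H: "hadamard_system R B L" and inv: "invariant_measure R B \<mu>"
  shows "orthogonal_exponentials \<mu> (Gamma_set (transpose R) L)"
  unfolding orthogonal_exponentials_def expo_mult_cnj
proof (intro ballI impI)
  fix g h assume gh: "g \<in> Gamma_set (transpose R) L" "h \<in> Gamma_set (transpose R) L" "g \<noteq> h"
  have "0 \<in> L"
    using H by (simp add: hadamard_system_def)
  obtain n c where c: "\<And>k. c k \<in> L"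
      "\<And>m. n < m \<Longrightarrow> g = (\<Sum>k<m. ((*v) (transpose R) ^^ k) (c k))"
    using Gamma_set_padE [OF gh(1) \<open>0 \<in> L\<close>] by metis
  obtain n' d where d: "\<And>k. d k \<in> L"
      "\<And>m. n' < m \<Longrightarrow> h = (\<Sum>k<m. ((*v) (transpose R) ^^ k) (d k))"
    using Gamma_set_padE [OF gh(2) \<open>0 \<in> L\<close>] by metis
  define m where "m = Suc (max n n')"
  have "g = (\<Sum>k<m. ((*v) (transpose R) ^^ k) (c k))"
    and "h = (\<Sum>k<m. ((*v) (transpose R) ^^ k) (d k))"
    by (rule c(2) d(2); simp add: m_def)+
  then show "(\<integral>x. expo (g - h) x \<partial>\<mu>) = 0"
    using integral_expo_digit_sum_diff_eq_0 [OF H inv c(1) d(1), where m = m] gh(3) by simp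
qed

lemma hadamard_system_infinite_Gamma_set:
  assumes "hadamard_system R B L" "card B \<ge> 2"
  shows "infinite (Gamma_set R B)"
proof -
  have "\<not> B \<subseteq> {0}"
    using assms(2) card_mono [of "{0}" B] by auto
  then obtain b where "b \<in> B" "b \<noteq> 0" by auto
  then show ?thesis
    using assms by (intro infinite_Gamma_set [of R B b]) (auto simp: hadamard_system_def)
qed

theorem corollary2p7:
  fixes R :: "real^'n^'n" and B L :: "(real^'n) set"
  assumes "hadamard_system R B L"
    and "card B \<ge> 2"
  shows "(\<forall>\<mu>\<^sub>L. invariant_measure (transpose R) L \<mu>\<^sub>L \<longrightarrow>
            orthogonal_exponentials \<mu>\<^sub>L (Gamma_set R B)) \<and>
         infinite (Gamma_set R B) \<and>
         (\<forall>\<mu>\<^sub>B. invariant_measure R B \<mu>\<^sub>B \<longrightarrow>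
            orthogonal_exponentials \<mu>\<^sub>B (Gamma_set (transpose R) L)) \<and>
         infinite (Gamma_set (transpose R) L)"
proof -
  have dual: "hadamard_system (transpose R) L B"
    using assms(1) by (rule hadamard_system_transpose)
  have "card L \<ge> 2"
    using assms by (simp add: hadamard_system_def)
  then show ?thesis
    using orthogonal_exponentials_Gamma_set [OF assms(1)] orthogonal_exponentials_Gamma_set [OF dual]
      hadamard_system_infinite_Gamma_set [OF assms] hadamard_system_infinite_Gamma_set [OF dual]
    by simp
qed

end
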